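(* Let $L$ be a PG-lattice and let $M$ be a faithful multiplication PG-lattice $L$-module with $I_M$ compact. If $N\in M$ is a $p$-pseudo-primary element, then $N\vee pI_M$ is a prime element of $M$, and hence $rad(N)$ is a prime element of $M$.
   Context: A multiplicative lattice $L$ is a complete lattice (least element $0$, greatest element $1$) with a commutative, associative multiplication that distributes over arbitrary joins and has $1$ as identity. An element $a$ of a complete lattice is compact if $a\leqslant \bigvee X$ implies $a\leqslant x_1\vee\cdots\vee x_n$ for finitely many $x_i\in X$; $L_\ast$ is the set of compact elements of $L$. Standing assumption: every element of $L$ is a join of compact elements of $L$, $1$ is compact, and finite products of compact elements of $L$ are compact. For $a,b\in L$, $(a:b)=\bigvee\{x\in L\mid xb\leqslant a\}$, and $\sqrt a=\bigvee\{x\in L_\ast\mid x^n\leqslant a\text{ for some positive integer }n\}$. An element $p\in L$ with $p<1$ is prime if for all $a,b\in L$, $ab\leqslant p$ implies $a\leqslant p$ or $b\leqslant p$. An element $e\in L$ is principal if $a\wedge be=((a:e)\wedge b)e$ and $(ae\vee b):e=(b:e)\vee a$ for all $a,b\in L$. $L$ is a PG-lattice if each element of $L$ is a join of principal elements of $L$. An $L$-module $M$ is a complete lattice (least element $O_M$, greatest element $I_M$) with a multiplication $L\times M\to M$, $(a,A)\mapsto aA$, such that $(\bigvee_\alpha a_\alpha)A=\bigvee_\alpha a_\alpha A$, $a(\bigvee_\alpha A_\alpha)=\bigvee_\alpha aA_\alpha$, $(ab)A=a(bA)$, $1A=A$, $0A=O_M$. For $A,B\in M$, $(A:B)=\bigvee\{x\in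 L\mid xB\leqslant A\}\in L$. $M$ is faithful if $(O_M:I_M)=0$; $M$ is a multiplication lattice module if every $N\in M$ has the form $N=aI_M$ with $a\in L$. An element $N\in M$ is principal if $(b\wedge(B:N))N=bN\wedge B$ and $b\vee(B:N)=((bN\vee B):N)$ for all $b\in L$, $B\in M$; $M$ is a PG-lattice $L$-module if each element of $M$ is a join of principal elements of $M$. $N\in M$ is proper if $N<I_M$. A proper $N\in M$ is prime if for all $a\in L$, $X\in M$, $aX\leqslant N$ implies $X\leqslant N$ or $aI_M\leqslant N$. For a proper $N$, $rad(N)=\bigwedge\{P\in M\mid P\text{ is prime and }N\leqslant P\}$ (the empty meet is $I_M$). A proper $N\in M$ is pseudo-primary if for all $a\in L$, $X\in M$, $aX\leqslant N$ implies $a\leqslant (N:I_M)$ or $X\leqslant rad(N)$. $N$ is $p$-pseudo-primary if $N$ is pseudo-primary and $p=\sqrt{(N:I_M)}$ is a prime element of $L$. *)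

theory Defs
  imports Main
begin

unbundle lattice_syntax

definition (in complete_lattice) compact_element :: "'a \<Rightarrow> bool" where
  "compact_element a \<longleftrightarrow> (\<forall>X. a \<le> \<Squnion>X \<longrightarrow> (\<exists>F. finite F \<and> F \<subseteq> X \<and> a \<le> \<Squnion>F))"

class mult_lattice = complete_lattice + comm_monoid_mult +
  assumes one_eq_top: "1 = \<top>"
    and mult_Sup_distrib: "a * \<Squnion>X = (\<Squnion>x\<in>X. a * x)"

context mult_lattice
begin

definition residual :: "'a \<Rightarrow> 'a \<Rightarrow> 'a" where
  "residual a b = \<Squnion>{x. x * b \<le> a}"

definition radical :: "'a \<Rightarrow> 'a" where
  "radical a = \<Squnion>{x. compact_element x \<and> (\<exists>n>0. x ^ n \<le> a)}"

definition prime_element :: "'a \<Rightarrow> bool" where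
  "prime_element p \<longleftrightarrow> p < 1 \<and> (\<forall>a b. a * b \<le> p \<longrightarrow> a \<le> p \<or> b \<le> p)"

definition principal_element :: "'a \<Rightarrow> bool" where
  "principal_element e \<longleftrightarrow>
    (\<forall>a b. a \<sqinter> (b * e) = (residual a e \<sqinter> b) * e \<and>
           residual ((a * e) \<squnion> b) e = residual b e \<squnion> a)"

end

text \<open>Products of finitely many compact elements are compact: the binary case together with
  compactness of the empty product \<open>1\<close>.\<close>

class compact_mult_lattice = mult_lattice +
  assumes join_of_compacts: "\<exists>X. (\<forall>x\<in>X. compact_element x) \<and> a = \<Squnion>X"
    and compact_one: "compact_element 1"
    and compact_mult: "compact_element a \<Longrightarrow> compact_element b \<Longrightarrow> compact_element (a * b)"

class PG_lattice = compact_mult_lattice +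
  assumes join_of_principals: "\<exists>X. (\<forall>x\<in>X. principal_element x) \<and> a = \<Squnion>X"

text \<open>The carriers of the lattice and of the module are types; an \<open>L\<close>-module structure is given by
  its scalar multiplication, which is an explicit argument of all notions below.\<close>

locale lattice_module =
  fixes smult :: "'l::mult_lattice \<Rightarrow> 'm::complete_lattice \<Rightarrow> 'm"  (infixr \<open>\<cdot>\<close> 75)
  assumes Sup_smult: "(\<Squnion>S) \<cdot> A = (\<Squnion>a\<in>S. a \<cdot> A)"
    and smult_Sup: "a \<cdot> (\<Squnion>T) = (\<Squnion>A\<in>T. a \<cdot> A)"
    and mult_smult: "(a * b) \<cdot> A = a \<cdot> (b \<cdot> A)"
    and one_smult: "1 \<cdot> A = A"
    and bot_smult: "\<bottom> \<cdot> A = \<bottom>"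

definition mod_residual ::
    "('l::mult_lattice \<Rightarrow> 'm::complete_lattice \<Rightarrow> 'm) \<Rightarrow> 'm \<Rightarrow> 'm \<Rightarrow> 'l" where
  "mod_residual smult A B = \<Squnion>{x. smult x B \<le> A}"

definition faithful_module ::
    "('l::mult_lattice \<Rightarrow> 'm::complete_lattice \<Rightarrow> 'm) \<Rightarrow> bool" where
  "faithful_module smult \<longleftrightarrow> mod_residual smult \<bottom> \<top> = \<bottom>"

definition multiplication_module ::
    "('l::mult_lattice \<Rightarrow> 'm::complete_lattice \<Rightarrow> 'm) \<Rightarrow> bool" where
  "multiplication_module smult \<longleftrightarrow> (\<forall>N. \<exists>a. N = smult a \<top>)"

definition mod_principal ::
    "('l::mult_lattice \<Rightarrow> 'm::complete_lattice \<Rightarrow> 'm) \<Rightarrow> 'm \<Rightarrow> bool" where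
  "mod_principal smult N \<longleftrightarrow>
    (\<forall>b B. smult (b \<sqinter> mod_residual smult B N) N = smult b N \<sqinter> B \<and>
           b \<squnion> mod_residual smult B N = mod_residual smult (smult b N \<squnion> B) N)"

definition PG_module ::
    "('l::mult_lattice \<Rightarrow> 'm::complete_lattice \<Rightarrow> 'm) \<Rightarrow> bool" where
  "PG_module smult \<longleftrightarrow> (\<forall>A. \<exists>X. (\<forall>N\<in>X. mod_principal smult N) \<and> A = \<Squnion>X)"

definition mod_prime ::
    "('l::mult_lattice \<Rightarrow> 'm::complete_lattice \<Rightarrow> 'm) \<Rightarrow> 'm \<Rightarrow> bool" where
  "mod_prime smult N \<longleftrightarrow>
    N < \<top> \<and> (\<forall>a X. smult a X \<le> N \<longrightarrow> X \<le> N \<or> smult a \<top> \<le> N)"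

definition mod_rad ::
    "('l::mult_lattice \<Rightarrow> 'm::complete_lattice \<Rightarrow> 'm) \<Rightarrow> 'm \<Rightarrow> 'm" where
  "mod_rad smult N = \<Sqinter>{P. mod_prime smult P \<and> N \<le> P}"

definition pseudo_primary ::
    "('l::mult_lattice \<Rightarrow> 'm::complete_lattice \<Rightarrow> 'm) \<Rightarrow> 'm \<Rightarrow> bool" where
  "pseudo_primary smult N \<longleftrightarrow>
    N < \<top> \<and>
    (\<forall>a X. smult a X \<le> N \<longrightarrow> a \<le> mod_residual smult N \<top> \<or> X \<le> mod_rad smult N)"

definition p_pseudo_primary ::
    "('l::mult_lattice \<Rightarrow> 'm::complete_lattice \<Rightarrow> 'm) \<Rightarrow> 'l \<Rightarrow> 'm \<Rightarrow> bool" where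
  "p_pseudo_primary smult p N \<longleftrightarrow>
    pseudo_primary smult N \<and> p = radical (mod_residual smult N \<top>) \<and> prime_element p"

end

theory Submission imports Defs begin

text \<open>
  The key point is that \<open>a\<top> \<le> p\<top>\<close> implies \<open>a \<le> p\<close> for a prime element \<open>p\<close> of \<open>L\<close>. Every element
  \<open>E\<close> of \<open>M\<close> is a multiple of \<open>\<top>\<close>, so \<open>aE \<le> pE\<close>, and for principal \<open>E\<close> this means
  \<open>a \<le> p \<squnion> (0 : E)\<close>. If \<open>a \<le> p\<close> fails, then no annihilator \<open>(0 : E)\<close> lies below \<open>p\<close>. By compactness
  \<open>\<top>\<close> is a join of finitely many principal elements, and the product of their annihilators
  annihilates \<open>\<top>\<close>, hence is \<open>0\<close> by faithfulness, contradicting primality of \<open>p\<close>. It follows that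
  \<open>p\<top>\<close> is prime. Finally, for \<open>p = \<surd>(N : \<top>)\<close> one has \<open>N \<le> p\<top> = rad(N)\<close>.
\<close>

lemma (in mult_lattice) le_radical:
  assumes "\<exists>X. (\<forall>x\<in>X. compact_element x) \<and> a = \<Squnion>X"
  shows "a \<le> radical a"
proof -
  obtain X where X: "\<forall>x\<in>X. compact_element x" "a = \<Squnion>X"
    using assms by blast
  have "x \<le> radical a" if "x \<in> X" for x
  proof -
    have "x ^ 1 \<le> a"
      using that X(2) by (simp add: Sup_upper)
    then show ?thesis
      unfolding radical_def using that X(1) by (intro Sup_upper) (auto intro!: exI[of _ 1])
  qed
  then show ?thesis
    unfolding X(2) by (intro Sup_least)
qed

context lattice_module
begin

lemma smult_sup: "a \<cdot> (A \<squnion> B) = a \<cdot> A \<squnion> a \<cdot> B"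
  using smult_Sup[of a "{A, B}"] by simp

lemma sup_smult: "(a \<squnion> b) \<cdot> A = a \<cdot> A \<squnion> b \<cdot> A"
  using Sup_smult[of "{a, b}" A] by simp

lemma smult_bot: "a \<cdot> \<bottom> = \<bottom>"
  using smult_Sup[of a "{}"] by simp

lemma smult_mono: "a \<cdot> A \<le> b \<cdot> B" if "a \<le> b" "A \<le> B"
proof -
  have "a \<cdot> A \<le> a \<cdot> B"
    using smult_sup[of a A B] that(2) by (simp add: le_iff_sup)
  also have "\<dots> \<le> b \<cdot> B"
    using sup_smult[of a b B] that(1) by (simp add: le_iff_sup)
  finally show ?thesis .
qed

text \<open>Residuation: as \<open>\<cdot>\<close> preserves joins in its first argument, the join
  defining \<open>mod_residual smult A B\<close> itself multiplies \<open>B\<close> into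
  \<open>A\<close>.\<close>

lemma le_mod_residual_iff: "x \<le> mod_residual smult A B \<longleftrightarrow> x \<cdot> B \<le> A"
proof
  assume "x \<le> mod_residual smult A B"
  then have "x \<cdot> B \<le> mod_residual smult A B \<cdot> B"
    by (simp add: smult_mono)
  also have "\<dots> \<le> A"
    unfolding mod_residual_def Sup_smult by (auto intro: SUP_least)
  finally show "x \<cdot> B \<le> A" .
next
  assume "x \<cdot> B \<le> A"
  then show "x \<le> mod_residual smult A B"
    unfolding mod_residual_def by (auto intro: Sup_upper)
qed

lemma smult_commute: "a \<cdot> (b \<cdot> A) = b \<cdot> (a \<cdot> A)"
  by (metis mult_smult mult.commute)

text \<open>The product of the annihilators kills every member of \<open>F\<close>, and primality
  keeps this product from lying below \<open>p\<close>. The empty product \<open>1\<close> starts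
  the induction because \<open>p < 1\<close>.\<close>

lemma finite_common_annihilator:
  assumes "prime_element p" "finite F" "\<And>E. E \<in> F \<Longrightarrow> \<not> mod_residual smult \<bottom> E \<le> p"
  shows "\<exists>z. \<not> z \<le> p \<and> (\<forall>E\<in>F. z \<cdot> E = \<bottom>)"
  using assms(2,3)
proof (induction F)
  case empty
  then show ?case
    using assms(1) by (auto simp: prime_element_def intro!: exI[of _ 1])
next
  case (insert E F)
  then obtain z where z: "\<not> z \<le> p" "\<forall>E\<in>F. z \<cdot> E = \<bottom>"
    by auto
  let ?y = "mod_residual smult \<bottom> E"
  have "\<not> ?y \<le> p" and "?y \<cdot> E = \<bottom>"
    using insert.prems le_mod_residual_iff[of ?y \<bottom> E] by (auto simp: le_bot)
  with z have "\<not> z * ?y \<le> p" "(z * ?y) \<cdot> E = \<bottom>" "\<forall>G\<in>F. (z * ?y) \<cdot> G = \<bottom>"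
    using assms(1) by (auto simp: prime_element_def mult_smult smult_bot smult_commute[of z])
  then show ?case
    by blast
qed

lemma smult_top_le_primeD:
  assumes "faithful_module smult" "multiplication_module smult" "PG_module smult"
    and "compact_element (\<top>::'m)" and "prime_element p" and "a \<cdot> \<top> \<le> p \<cdot> \<top>"
  shows "a \<le> p"
proof (rule ccontr)
  assume "\<not> a \<le> p"
  have ann: "\<not> mod_residual smult \<bottom> E \<le> p" if "mod_principal smult E" for E
  proof
    assume "mod_residual smult \<bottom> E \<le> p"
    obtain e where "E = e \<cdot> \<top>"
      using assms(2) unfolding multiplication_module_def by blast
    with assms(6) have "a \<cdot> E \<le> p \<cdot> E"
      by (simp add: smult_commute[of _ e] smult_mono)
    \<comment> \<open>Joining with \<open>\<bottom>\<close> gives the shape of the second identity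
      for principal elements, taken at \<open>B = \<bottom>\<close>.\<close>
    then have "a \<le> mod_residual smult (p \<cdot> E \<squnion> \<bottom>) E"
      by (simp add: le_mod_residual_iff)
    also have "\<dots> = p \<squnion> mod_residual smult \<bottom> E"
      using that unfolding mod_principal_def by simp
    also have "\<dots> = p"
      using \<open>mod_residual smult \<bottom> E \<le> p\<close> by (simp add: sup_absorb1)
    finally show False
      using \<open>\<not> a \<le> p\<close> by simp
  qed
  obtain X where X: "\<forall>E\<in>X. mod_principal smult E" "\<top> = \<Squnion>X"
    using assms(3) unfolding PG_module_def by blast
  obtain F where F: "finite F" "F \<subseteq> X" "\<top> \<le> \<Squnion>F"
    using assms(4) X(2) unfolding compact_element_def by (metis order_refl)
  obtain z where z: "\<not> z \<le> p" "\<forall>E\<in>F. z \<cdot> E = \<bottom>"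
    using finite_common_annihilator[OF assms(5) F(1)] ann X(1) F(2) by blast
  have "z \<cdot> \<top> = z \<cdot> \<Squnion>F"
    using F(3) by (simp add: top_unique)
  also have "\<dots> = \<bottom>"
    using z(2) by (simp add: smult_Sup)
  finally have "z \<le> mod_residual smult \<bottom> \<top>"
    by (simp add: le_mod_residual_iff)
  with assms(1) z(1) show False
    by (auto simp: faithful_module_def dest: le_bot)
qed

lemma mod_prime_smult_top:
  assumes "faithful_module smult" "multiplication_module smult" "PG_module smult"
    and "compact_element (\<top>::'m)" and "prime_element p"
  shows "mod_prime smult (p \<cdot> \<top>)"
proof -
  note cancel = smult_top_le_primeD[OF assms]
  \<comment> \<open>Otherwise cancelling \<open>\<top>\<close> from
    \<open>1 \<cdot> \<top> \<le> p \<cdot> \<top>\<close> gives \<open>1 \<le> p\<close>.\<close>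
  have "p \<cdot> \<top> \<noteq> \<top>"
    using cancel[of 1] assms(5) by (auto simp: one_smult prime_element_def)
  moreover have "X \<le> p \<cdot> \<top> \<or> a \<cdot> \<top> \<le> p \<cdot> \<top>" if "a \<cdot> X \<le> p \<cdot> \<top>" for a X
  proof -
    obtain x where x: "X = x \<cdot> \<top>"
      using assms(2) unfolding multiplication_module_def by blast
    then have "a * x \<le> p"
      using that cancel by (simp add: mult_smult)
    then show ?thesis
      using assms(5) x by (auto simp: prime_element_def intro: smult_mono)
  qed
  ultimately show ?thesis
    by (simp add: mod_prime_def less_top)
qed

text \<open>Primality splits one factor \<open>x\<close> off
  \<open>x \<cdot> (x ^ n \<cdot> \<top>)\<close>; at exponent 0 the assumption contradicts that
  \<open>P\<close> is proper.\<close>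

lemma mod_prime_power_smultD:
  assumes "mod_prime smult P" "x ^ n \<cdot> \<top> \<le> P"
  shows "x \<cdot> \<top> \<le> P"
  using assms(2)
proof (induction n)
  case 0
  then show ?case
    using assms(1) by (simp add: one_smult mod_prime_def top_unique)
next
  case (Suc n)
  then show ?case
    using assms(1) by (auto simp: mod_prime_def mult_smult)
qed

text \<open>It suffices to compare each generator \<open>x\<close> of the radical with each prime
  \<open>P\<close> above \<open>N\<close>, where
  \<open>x ^ n \<cdot> \<top> \<le> N \<le> P\<close>.\<close>

lemma radical_smult_le_mod_rad: "radical (mod_residual smult N \<top>) \<cdot> \<top> \<le> mod_rad smult N"
proof -
  have "x \<cdot> \<top> \<le> P"
    if "mod_prime smult P" "N \<le> P" "x ^ n \<le> mod_residual smult N \<top>" for x n P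
    using that le_mod_residual_iff mod_prime_power_smultD order_trans by metis
  then show ?thesis
    unfolding radical_def mod_rad_def Sup_smult by (auto intro!: Inf_greatest SUP_least)
qed

end

theorem theorem2p19:
  fixes smult :: "'l::PG_lattice \<Rightarrow> 'm::complete_lattice \<Rightarrow> 'm"
    and p :: 'l and N :: 'm
  assumes "lattice_module smult"
    and "faithful_module smult"
    and "multiplication_module smult"
    and "PG_module smult"
    and "compact_element (\<top>::'m)"
    and "p_pseudo_primary smult p N"
  shows "mod_prime smult (N \<squnion> smult p \<top>) \<and> mod_prime smult (mod_rad smult N)"
proof -
  interpret lattice_module smult
    by (fact assms(1))
  have p: "p = radical (mod_residual smult N \<top>)" "prime_element p"
    using assms(6) by (auto simp: p_pseudo_primary_def)
  have prime: "mod_prime smult (smult p \<top>)"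
    using mod_prime_smult_top[OF assms(2-5) p(2)] .
  obtain a where a: "N = smult a \<top>"
    using assms(3) unfolding multiplication_module_def by blast
  then have "a \<le> mod_residual smult N \<top>"
    by (simp add: le_mod_residual_iff)
  also have "\<dots> \<le> p"
    unfolding p(1) by (rule le_radical[OF join_of_compacts])
  finally have le: "N \<le> smult p \<top>"
    unfolding a by (simp add: smult_mono)
  \<comment> \<open>\<open>p \<cdot> \<top>\<close> is itself one of the primes in the meet.\<close>
  then have "mod_rad smult N \<le> smult p \<top>"
    unfolding mod_rad_def using prime by (auto intro: Inf_lower)
  moreover have "smult p \<top> \<le> mod_rad smult N"
    unfolding p(1) by (rule radical_smult_le_mod_rad)
  ultimately have "mod_rad smult N = smult p \<top>"
    by (rule antisym)
  \<comment> \<open>Since \<open>N \<le> p \<cdot> \<top>\<close>, the join collapses, so both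
    claims concern the same prime element.\<close>
  with prime le show ?thesis
    by (simp add: sup_absorb2)
qed

end
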